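(* Let $I\subseteq\mathbb{R}$ and assume $f_1,\dots,f_n\colon I\to\mathbb{R}$ with the properties $$\sum_{i=1}^n f_i(t)=0,\quad f_1(t)\le f_2(t)\le\dots\le f_n(t)\quad\text{and}\quad f_1'(t)\le f_2'(t)\le\dots\le f_n'(t)$$ for all $t\in I$. Additionally, let $h\colon D\to\mathbb{R}$ be monotone increasing and convex, where $D\subseteq\mathbb{R}$ is such that $h(f_i(t))$ is well defined for all $i\in\{1,\dots,n\}$ and all $t\in I$. Define furthermore $H\colon I\to\mathbb{R}$ by $$H(t)=\sum_{i=1}^n e^{h(f_i(t))}.$$ Then $H'(t)\ge 0$ for all $t\in I$ and $H$ is monotone increasing.
   Context: A prime denotes the derivative with respect to $t$. "Monotone increasing" is meant in the weak (non-strict) sense.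
   Formalization: I is taken to be a nondegenerate interval (monotonicity of H fails on disconnected I) and the f_i differentiable; since convex h need not be differentiable, H'(t) ≥ 0 is shown wherever H'(t) exists, and it exists wherever h is differentiable at all f_i(t). *)

theory Defs
  imports "HOL-Analysis.Analysis"
begin

end

theory Submission
  imports Defs
begin

text \<open>For \<open>s \<le> t\<close> the increments \<open>f i t - f i s\<close> are sorted and sum to zero, so the indices whose value
  decreases from \<open>s\<close> to \<open>t\<close> precede those whose value increases. Since \<open>exp \<circ> h\<close> is convex, its
  slopes over the decreasing indices are at most its slopes over the increasing ones, and
  any number \<open>c\<close> separating them gives \<open>H t - H s \<ge> c * (\<Sum>i. f i t - f i s) = 0\<close>. Comparing
  values instead of derivatives avoids any smoothness or continuity requirement on \<open>h\<close>.\<close>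

lemma convex_on_exp_comp:
  fixes h :: "'a::real_vector \<Rightarrow> real"
  assumes "convex_on D h"
  shows "convex_on D (\<lambda>x. exp (h x))"
proof (rule convex_onI)
  show "convex D"
    using assms by (rule convex_on_imp_convex)
  fix u :: real and x y
  assume u: "0 < u" "u < 1" and xy: "x \<in> D" "y \<in> D"
  have "exp (h ((1 - u) *\<^sub>R x + u *\<^sub>R y)) \<le> exp ((1 - u) * h x + u * h y)"
    using convex_onD[OF assms] u xy by simp
  also have "\<dots> \<le> (1 - u) * exp (h x) + u * exp (h y)"
    using convex_onD[OF exp_convex, of u "h x" "h y"] u by simp
  finally show "exp (h ((1 - u) *\<^sub>R x + u *\<^sub>R y)) \<le> (1 - u) * exp (h x) + u * exp (h y)" .
qed

text \<open>Slopes over adjacent intervals increase; when \<open>q < r\<close>, the slope over the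
  middle interval from \<open>q\<close> to \<open>r\<close> links the two outer ones.\<close>

lemma convex_on_slope_mono:
  fixes G :: "real \<Rightarrow> real"
  assumes G: "convex_on D G" and D: "p \<in> D" "s \<in> D" and ord: "p < q" "q \<le> r" "r < s"
  shows "(G q - G p) / (q - p) \<le> (G s - G r) / (s - r)"
proof -
  have mem: "x \<in> D" if "p \<le> x" "x \<le> s" for x
    using convex_on_imp_convex[OF G] D that
    by (meson is_interval_convex_1 mem_is_interval_1_I)
  have step: "(G y - G x) / (y - x) \<le> (G z - G y) / (z - y)"
    if "x \<in> D" "z \<in> D" "x < y" "y < z" for x y z
  proof -
    have "(G x - G y) / (x - y) \<le> (G y - G z) / (y - z)"
      using convex_on_slope_le[OF G that] by linarith
    then show ?thesis
      by (metis minus_diff_eq minus_divide_divide)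
  qed
  show ?thesis
  proof (cases "q = r")
    case True
    then show ?thesis using step[of p s q] D ord by simp
  next
    case False
    then have "q < r" using ord by simp
    then have "(G q - G p) / (q - p) \<le> (G r - G q) / (r - q)"
      and "(G r - G q) / (r - q) \<le> (G s - G r) / (s - r)"
      using step[of p r q] step[of q s r] D ord mem[of q] mem[of r] by auto
    then show ?thesis by simp
  qed
qed

lemma finite_sets_separating_element:
  fixes X Y :: "'a::{linorder, zero} set"
  assumes "finite X" "finite Y" and "\<And>x y. x \<in> X \<Longrightarrow> y \<in> Y \<Longrightarrow> x \<le> y"
  obtains c where "\<And>x. x \<in> X \<Longrightarrow> x \<le> c" and "\<And>y. y \<in> Y \<Longrightarrow> c \<le> y"
proof (cases "X = {}")
  case True
  then show ?thesis
    \<comment> \<open>If \<open>Y\<close> is empty too, \<open>Min Y\<close> is an unspecified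
      value, but both conditions are then vacuous.\<close>
    using that[of "Min Y"] assms by simp
next
  case False
  then show ?thesis
    using that[of "Max X"] assms by simp
qed

text \<open>A Karamata-type inequality: passing from \<open>b\<close> to \<open>a\<close> spreads
  the points outwards while keeping their sum. By \<open>sep\<close>, each interval from
  \<open>a i\<close> to \<open>b i\<close> traversed leftwards lies to the left of each interval
  from \<open>b j\<close> to \<open>a j\<close> traversed rightwards, so one number \<open>c\<close>
  separates their slopes and plays the role of a subgradient.\<close>

lemma convex_on_sum_le_of_separated:
  fixes G :: "real \<Rightarrow> real" and a b :: "'i \<Rightarrow> real"
  assumes G: "convex_on D G" and fin: "finite A"
    and D: "\<And>i. i \<in> A \<Longrightarrow> a i \<in> D" "\<And>i. i \<in> A \<Longrightarrow> b i \<in> D"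
    and sum_eq: "(\<Sum>i\<in>A. a i) = (\<Sum>i\<in>A. b i)"
    and sep: "\<And>i j. i \<in> A \<Longrightarrow> j \<in> A \<Longrightarrow> a i < b i \<Longrightarrow> b j < a j \<Longrightarrow> b i \<le> b j"
  shows "(\<Sum>i\<in>A. G (b i)) \<le> (\<Sum>i\<in>A. G (a i))"
proof -
  define slope where "slope i = (G (a i) - G (b i)) / (a i - b i)" for i
  have slope_le: "slope i \<le> slope j"
    if "i \<in> A" "j \<in> A" "a i < b i" "b j < a j" for i j
  proof -
    have "(G (b i) - G (a i)) / (b i - a i) \<le> slope j"
      unfolding slope_def using convex_on_slope_mono[OF G] D sep that by blast
    then show ?thesis
      unfolding slope_def by (metis minus_diff_eq minus_divide_divide)
  qed
  obtain c where c1: "\<And>x. x \<in> slope ` {i \<in> A. a i < b i} \<Longrightarrow> x \<le> c"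
    and c2: "\<And>y. y \<in> slope ` {i \<in> A. b i < a i} \<Longrightarrow> c \<le> y"
    by (rule finite_sets_separating_element
        [of "slope ` {i \<in> A. a i < b i}" "slope ` {i \<in> A. b i < a i}"])
      (use fin slope_le in auto)
  \<comment> \<open>For \<open>a i < b i\<close> the slope is at most \<open>c\<close>, and
    multiplying by the negative \<open>a i - b i\<close> reverses the inequality, so both signs give
    the same bound.\<close>
  have "c * (a i - b i) \<le> G (a i) - G (b i)" if "i \<in> A" for i
  proof -
    consider "a i < b i" | "a i = b i" | "b i < a i"
      by linarith
    then show ?thesis
    proof cases
      case 1
      then have "slope i \<le> c" using that c1 by blast
      then show ?thesis using 1 by (simp add: slope_def neg_divide_le_eq)
    next
      case 3
      then have "c \<le> slope i" using that c2 by blast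
      then show ?thesis using 3 by (simp add: slope_def pos_le_divide_eq)
    qed simp
  qed
  then have "(\<Sum>i\<in>A. c * (a i - b i)) \<le> (\<Sum>i\<in>A. G (a i) - G (b i))"
    by (rule sum_mono)
  moreover have "(\<Sum>i\<in>A. c * (a i - b i)) = 0"
    using sum_eq by (simp add: sum_subtractf flip: sum_distrib_left)
  ultimately show ?thesis
    by (simp add: sum_subtractf)
qed

text \<open>Mean value theorem on \<open>{s..t}\<close>. Derivatives are taken within
  \<open>I\<close>, so that endpoints belonging to \<open>I\<close> are covered by one-sided
  derivatives.\<close>

lemma has_real_derivative_nonneg_on_interval_imp_le:
  fixes g :: "real \<Rightarrow> real"
  assumes I: "is_interval I" "s \<in> I" "t \<in> I" "s \<le> t"
    and deriv: "\<And>x. x \<in> I \<Longrightarrow> (g has_real_derivative g' x) (at x within I)"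
    and nonneg: "\<And>x. x \<in> I \<Longrightarrow> 0 \<le> g' x"
  shows "g s \<le> g t"
proof -
  have sub: "{s..t} \<subseteq> I"
    using mem_is_interval_1_I[OF I(1-3)] by auto
  have "(g has_derivative (*) (g' x)) (at x within {s..t})" if "s \<le> x" "x \<le> t" for x
  proof -
    have "x \<in> I"
      using sub that by auto
    then have "(g has_derivative (*) (g' x)) (at x within I)"
      using deriv by (simp add: has_field_derivative_def)
    then show ?thesis
      using sub by (rule has_derivative_subset)
  qed
  then obtain x where "x \<in> {s..t}" "g t - g s = g' x * (t - s)"
    using mvt_very_simple[OF I(4), of g "\<lambda>x. (*) (g' x)"] by blast
  moreover have "0 \<le> g' x * (t - s)"
    using nonneg sub \<open>x \<in> {s..t}\<close> I(4) by (intro mult_nonneg_nonneg) auto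
  ultimately show ?thesis by simp
qed

text \<open>The difference quotients are nonnegative on both sides of \<open>t\<close>, hence so is
  their limit. At an isolated point every \<open>d\<close> would count as a derivative, which
  \<open>t islimpt S\<close> rules out.\<close>

lemma mono_on_imp_has_real_derivative_nonneg:
  fixes g :: "real \<Rightarrow> real"
  assumes "mono_on S g" "t \<in> S" "t islimpt S" "(g has_real_derivative d) (at t within S)"
  shows "0 \<le> d"
proof (rule tendsto_lowerbound)
  show "((\<lambda>x. (g x - g t) / (x - t)) \<longlongrightarrow> d) (at t within S)"
    using assms(4) by (simp add: has_field_derivative_iff)
  have "0 \<le> (g x - g t) / (x - t)" if "x \<in> S" for x
    using mono_onD[OF assms(1), of x t] mono_onD[OF assms(1), of t x] assms(2) that
    by (cases "x \<le> t") (auto simp: zero_le_divide_iff)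
  then show "\<forall>\<^sub>F x in at t within S. 0 \<le> (g x - g t) / (x - t)"
    by (simp add: eventually_at_filter)
  show "at t within S \<noteq> bot"
    using assms(3) by (simp add: trivial_limit_within)
qed

lemma mono_of_Suc_le_on_interval:
  fixes g :: "nat \<Rightarrow> 'a::order"
  assumes "i \<le> j" "i \<in> {1..n}" "j \<in> {1..n}"
    and "\<And>k. k \<in> {1..<n} \<Longrightarrow> g k \<le> g (Suc k)"
  shows "g i \<le> g j"
  using assms(1,3)
proof (induction j rule: dec_induct)
  case (step k)
  then have "g i \<le> g k" "g k \<le> g (Suc k)"
    using assms(2,4) by auto
  then show ?case by (rule order_trans)
qed simp

theorem theorem4p6:
  fixes I D :: "real set" and n :: nat
    and f f' :: "nat \<Rightarrow> real \<Rightarrow> real" and h H :: "real \<Rightarrow> real"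
  assumes I_interval: "is_interval I" and I_nondegenerate: "interior I \<noteq> {}"
    and f_deriv: "\<And>i t. i \<in> {1..n} \<Longrightarrow> t \<in> I \<Longrightarrow>
                    (f i has_real_derivative f' i t) (at t within I)"
    and f_sum: "\<And>t. t \<in> I \<Longrightarrow> (\<Sum>i=1..n. f i t) = 0"
    and f_sorted: "\<And>i t. i \<in> {1..<n} \<Longrightarrow> t \<in> I \<Longrightarrow> f i t \<le> f (Suc i) t"
    and f'_sorted: "\<And>i t. i \<in> {1..<n} \<Longrightarrow> t \<in> I \<Longrightarrow> f' i t \<le> f' (Suc i) t"
    and h_mono: "mono_on D h"
    and h_convex: "convex_on D h"
    and f_in_D: "\<And>i t. i \<in> {1..n} \<Longrightarrow> t \<in> I \<Longrightarrow> f i t \<in> D"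
    and H_eq: "\<And>t. t \<in> I \<Longrightarrow> H t = (\<Sum>i=1..n. exp (h (f i t)))"
  shows "(\<forall>t\<in>I. (\<forall>i\<in>{1..n}. h differentiable (at (f i t) within D)) \<longrightarrow>
              H differentiable (at t within I)) \<and>
         (\<forall>t\<in>I. \<forall>H't. (H has_real_derivative H't) (at t within I) \<longrightarrow> H't \<ge> 0) \<and>
         mono_on I H"
proof (intro conjI ballI impI allI)
  show mono: "mono_on I H"
  proof (rule mono_onI)
    fix s t
    assume st: "s \<in> I" "t \<in> I" "s \<le> t"
    have incr: "f i t - f i s \<le> f j t - f j s"
      if "i \<le> j" "i \<in> {1..n}" "j \<in> {1..n}" for i j
    proof -
      \<comment> \<open>Comparing increments amounts to monotonicity of the gap between
        \<open>f j\<close> and \<open>f i\<close>, whose derivative is nonnegative by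
        \<open>f'_sorted\<close>.\<close>
      have "f j s - f i s \<le> f j t - f i t"
      proof (rule has_real_derivative_nonneg_on_interval_imp_le[OF I_interval st])
        fix x
        assume "x \<in> I"
        then show "((\<lambda>x. f j x - f i x) has_real_derivative f' j x - f' i x) (at x within I)"
          using f_deriv that by (intro DERIV_diff) auto
        show "0 \<le> f' j x - f' i x"
          using mono_of_Suc_le_on_interval[of i j n "\<lambda>k. f' k x"] that f'_sorted \<open>x \<in> I\<close> by simp
      qed
      then show ?thesis by simp
    qed
    have "(\<Sum>i=1..n. exp (h (f i s))) \<le> (\<Sum>i=1..n. exp (h (f i t)))"
    \<comment> \<open>Here \<open>b\<close> holds the values at \<open>s\<close> and
      \<open>a\<close> those at \<open>t\<close>; both sums vanish, and separation has to be checked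
      at time \<open>s\<close>.\<close>
    proof (rule convex_on_sum_le_of_separated[OF convex_on_exp_comp[OF h_convex]])
      fix i j
      assume ij: "i \<in> {1..n}" "j \<in> {1..n}" "f i t < f i s" "f j s < f j t"
      \<comment> \<open>Otherwise \<open>incr\<close> would bound the positive increment of index
        \<open>j\<close> by the negative one of index \<open>i\<close>.\<close>
      then have "i \<le> j"
        using incr[of j i] by force
      then show "f i s \<le> f j s"
        using mono_of_Suc_le_on_interval[of i j n "\<lambda>k. f k s"] ij f_sorted st by simp
    qed (use f_in_D f_sum st in auto)
    then show "H s \<le> H t"
      using H_eq st by simp
  qed

  fix t
  assume t: "t \<in> I"
  have "I \<noteq> {x}" for x
    using I_nondegenerate by auto
  \<comment> \<open>A connected set that is not a single point has no isolated points.\<close>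
  then have "t islimpt I"
    using connected_imp_perfect[of I t] I_interval t by (simp add: is_interval_connected_1)
  then show "0 \<le> d" if "(H has_real_derivative d) (at t within I)" for d
    using mono_on_imp_has_real_derivative_nonneg[OF mono t] that by blast

  show "H differentiable (at t within I)"
    if h_diff: "\<forall>i\<in>{1..n}. h differentiable (at (f i t) within D)"
  proof -
    have "(\<lambda>x. exp (h (f i x))) differentiable (at t within I)" if i: "i \<in> {1..n}" for i
    proof -
      have "f i differentiable (at t within I)"
        using f_deriv[OF i t] by (auto simp: real_differentiable_def)
      \<comment> \<open>The chain rule needs differentiability of \<open>h\<close> only along the
        image of \<open>I\<close>, so the one within \<open>D\<close> is restricted.\<close>
      moreover have "h differentiable (at (f i t) within f i ` I)"
      proof (rule differentiable_within_subset)
        show "h differentiable (at (f i t) within D)"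
          using h_diff i by blast
        show "f i ` I \<subseteq> D"
          using f_in_D i by blast
      qed
      ultimately have "(h \<circ> f i) differentiable (at t within I)"
        by (rule differentiable_chain_within)
      then obtain d where "((\<lambda>x. h (f i x)) has_real_derivative d) (at t within I)"
        by (auto simp: real_differentiable_def o_def)
      then have "((\<lambda>x. exp (h (f i x))) has_real_derivative exp (h (f i t)) * d) (at t within I)"
        by (auto intro!: derivative_eq_intros)
      then show ?thesis
        by (auto simp: real_differentiable_def)
    qed
    then have "(\<lambda>x. \<Sum>i=1..n. exp (h (f i x))) differentiable (at t within I)"
      by (intro differentiable_sum) auto
    \<comment> \<open>\<open>H\<close> agrees with the sum on all of \<open>I\<close>, so any
      positive radius, here 1, serves for the transfer.\<close>
    then show ?thesis
      by (rule differentiable_transform_within[OF _ zero_less_one t]) (simp add: H_eq)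
  qed
qed

end
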